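(* Let $q$ be a power of an odd prime $p$, let $G=\mathrm{SL}(2,q)$ and $t=-I$. Let $\mathfrak{S}$ be the set of all elements of $G$ of order $p$ or $2p$. Then the Cayley graph $\Gamma=\mathrm{Cay}(G,\{t\}\cup\mathfrak{S})$ is connected, and for every $x\in G$ perfect state transfer occurs (at some time) between the vertices $x$ and $xt$ of $\Gamma$.
   Context: $\mathrm{Cay}(G,T)$ has vertex set $G$, $g\sim h$ iff $hg^{-1}\in T$. Perfect state transfer between vertices $a\neq b$ of a graph with adjacency matrix $A$ means $\exp(-i\tau A)e_a=\gamma e_b$ for some $\tau\in\mathbb{R}$ and $|\gamma|=1$, with $e_v$ the standard basis vectors. *)

theory Defs
  imports
    "HOL-Analysis.Analysis"
    "HOL-Algebra.Multiplicative_Group"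
    "Graph_Theory.Pair_Digraph"
    "Graph_Theory.Digraph_Component"
    "HOL-Computational_Algebra.Primes"
begin

definition SL :: "('a::field ^ 'n ^ 'n) monoid" where
  "SL = \<lparr>carrier = {A. det A = 1}, mult = (**), one = mat 1\<rparr>"

lemma group_SL: "group (SL :: ('a::field ^ 'n ^ 'n) monoid)"
proof (rule groupI)
  fix A :: "'a ^ 'n ^ 'n" assume "A \<in> carrier SL"
  then have A: "det A = 1" by (simp add: SL_def)
  then have "invertible A" by (simp add: invertible_det_nz)
  then obtain B where B: "A ** B = mat 1" "B ** A = mat 1" by (auto simp: invertible_def)
  have "det B * det A = 1" using B(2) by (metis det_mul det_I)
  then have "det B = 1" using A by simp
  then show "\<exists>B\<in>carrier SL. B \<otimes>\<^bsub>SL\<^esub> A = \<one>\<^bsub>SL\<^esub>" using B by (auto simp: SL_def)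
qed (auto simp: SL_def det_mul matrix_mul_assoc)

definition cayley_graph :: "('g, 'b) monoid_scheme \<Rightarrow> 'g set \<Rightarrow> 'g pair_pre_digraph" where
  "cayley_graph G T =
     \<lparr>pverts = carrier G,
      parcs = {(g, h). g \<in> carrier G \<and> h \<in> carrier G \<and> h \<otimes>\<^bsub>G\<^esub> inv\<^bsub>G\<^esub> g \<in> T}\<rparr>"

text \<open>
  Square matrices indexed by a finite set \<open>V\<close> are functions \<open>'v \<Rightarrow> 'v \<Rightarrow> complex\<close>, and vectors are
  functions \<open>'v \<Rightarrow> complex\<close>; only the entries with indices in \<open>V\<close> are meaningful.
\<close>

primrec mat_power :: "'v set \<Rightarrow> ('v \<Rightarrow> 'v \<Rightarrow> complex) \<Rightarrow> nat \<Rightarrow> 'v \<Rightarrow> 'v \<Rightarrow> complex" where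
  "mat_power V M 0 = (\<lambda>u v. of_bool (u = v))"
| "mat_power V M (Suc k) = (\<lambda>u v. \<Sum>w\<in>V. M u w * mat_power V M k w v)"

definition mat_exp :: "'v set \<Rightarrow> ('v \<Rightarrow> 'v \<Rightarrow> complex) \<Rightarrow> 'v \<Rightarrow> 'v \<Rightarrow> complex" where
  "mat_exp V M u v = (\<Sum>k. mat_power V M k u v / fact k)"

definition mat_vec :: "'v set \<Rightarrow> ('v \<Rightarrow> 'v \<Rightarrow> complex) \<Rightarrow> ('v \<Rightarrow> complex) \<Rightarrow> 'v \<Rightarrow> complex" where
  "mat_vec V M x u = (\<Sum>v\<in>V. M u v * x v)"

text \<open>The series defining the exponential converges, so that \<open>suminf\<close> takes no junk value.\<close>

lemma norm_mat_power_le: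
  assumes "finite V" "u \<in> V" and C: "\<And>u v. u \<in> V \<Longrightarrow> v \<in> V \<Longrightarrow> norm (M u v) \<le> C"
  shows "norm (mat_power V M k u v) \<le> (real (card V) * C) ^ k"
  using \<open>u \<in> V\<close>
proof (induction k arbitrary: u)
  case (Suc k)
  have "norm (mat_power V M (Suc k) u v) \<le> (\<Sum>w\<in>V. C * (real (card V) * C) ^ k)"
    unfolding mat_power.simps
    by (rule sum_norm_le, unfold norm_mult, rule mult_mono)
       (use Suc C order_trans[OF norm_ge_zero C] in auto)
  then show ?case by (simp add: mult_ac)
qed auto

lemma sums_mat_exp:
  assumes "finite V" "u \<in> V"
  shows "(\<lambda>k. mat_power V M k u v / fact k) sums mat_exp V M u v"
proof -
  define C where "C = (\<Sum>a\<in>V. \<Sum>b\<in>V. norm (M a b))"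
  have C: "norm (M a b) \<le> C" if "a \<in> V" "b \<in> V" for a b
  proof -
    have "norm (M a b) \<le> (\<Sum>b\<in>V. norm (M a b))"
      by (rule member_le_sum) (use that assms in auto)
    also have "\<dots> \<le> C"
      unfolding C_def by (rule member_le_sum) (use that assms in \<open>auto intro: sum_nonneg\<close>)
    finally show ?thesis .
  qed
  have "summable (\<lambda>k. (real (card V) * C) ^ k / fact k)"
    using summable_exp[of "real (card V) * C"] by (simp add: field_simps)
  then have "summable (\<lambda>k. mat_power V M k u v / fact k)"
    by (rule summable_comparison_test'[where N = 0])
       (auto simp: norm_divide intro!: divide_right_mono norm_mat_power_le assms C)
  then show ?thesis unfolding mat_exp_def by (rule summable_sums)
qed

definition adjacency_matrix :: "'v pair_pre_digraph \<Rightarrow> 'v \<Rightarrow> 'v \<Rightarrow> complex" where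
  "adjacency_matrix \<Gamma> u v = of_bool (u \<rightarrow>\<^bsub>with_proj \<Gamma>\<^esub> v)"

definition basis_vec :: "'v \<Rightarrow> 'v \<Rightarrow> complex" where
  "basis_vec a v = of_bool (v = a)"

definition perfect_state_transfer :: "'v pair_pre_digraph \<Rightarrow> 'v \<Rightarrow> 'v \<Rightarrow> bool" where
  "perfect_state_transfer \<Gamma> a b \<longleftrightarrow>
     a \<in> pverts \<Gamma> \<and> b \<in> pverts \<Gamma> \<and> a \<noteq> b \<and>
     (\<exists>(\<tau>::real) (\<gamma>::complex). norm \<gamma> = 1 \<and>
        (\<forall>u\<in>pverts \<Gamma>.
           mat_vec (pverts \<Gamma>)
             (mat_exp (pverts \<Gamma>) (\<lambda>v w. - \<i> * of_real \<tau> * adjacency_matrix \<Gamma> v w))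
             (basis_vec a) u
           = \<gamma> * basis_vec b u))"

end

(* Let U be the set of nontrivial unipotents (determinant 1, trace 2).  In characteristic p these are
   the elements of order p, and -U is the set of elements of order 2p.  For nonzero vectors z, w the
   number of u in U with u z = w is q - 1 if w = z, 0 if w is another multiple of z, and 1 otherwise.
   The last case shows that U generates the group, hence connectedness.  The count also replaces
   character theory: it shows that f |-> (g |-> sum over u in U of f (u g)) acts on the span of the
   delta function at a, two permutation characters and the constants, with eigenvalues q^2 - 1, 0,
   q - 1 and -(q + 1), all even.  So the adjacency operator acts as 1 + 4 m (m an integer) on the
   components of the delta function even under g |-> -g, and as -1 on its odd part.  At time pi/2 the
   evolution is therefore -i on the even part and i on the odd part, i.e. -i times translation by t. *)
theory Submission
  imports Defs
begin

section \<open>Matrix exponentials on eigenvectors\<close>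

lemma mat_power_eigenvector:
  assumes "finite V" and f: "\<And>u. u \<in> V \<Longrightarrow> mat_vec V M f u = c * f u" and "u \<in> V"
  shows "mat_vec V (mat_power V M k) f u = c ^ k * f u"
  using \<open>u \<in> V\<close>
proof (induction k arbitrary: u)
  case 0
  have "of_bool (u = v) * f v = (if u = v then f v else 0)" for v
    by simp
  then show ?case using 0 \<open>finite V\<close> by (simp add: mat_vec_def)
next
  case (Suc k)
  have "mat_vec V (mat_power V M (Suc k)) f u = (\<Sum>v\<in>V. \<Sum>w\<in>V. M u w * mat_power V M k w v * f v)"
    by (simp add: mat_vec_def sum_distrib_right)
  also have "\<dots> = (\<Sum>w\<in>V. M u w * mat_vec V (mat_power V M k) f w)"
    by (subst sum.swap) (simp add: mat_vec_def sum_distrib_left mult.assoc)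
  also have "\<dots> = c ^ k * mat_vec V M f u"
    using Suc.IH by (simp add: mat_vec_def sum_distrib_left mult_ac)
  finally show ?case using f[OF Suc.prems] by simp
qed

text \<open>The finite sum over \<open>V\<close> commutes with the convergent series, and each power
  of \<open>M\<close> multiplies \<open>f\<close> by the same power of \<open>c\<close>. The
  evolution can therefore be computed from a decomposition of the start vector into
  eigenvectors.\<close>

lemma mat_exp_eigenvector:
  assumes "finite V" and f: "\<And>u. u \<in> V \<Longrightarrow> mat_vec V M f u = c * f u" and "u \<in> V"
  shows "mat_vec V (mat_exp V M) f u = exp c * f u"
proof -
  have "(\<lambda>k. \<Sum>v\<in>V. mat_power V M k u v / fact k * f v) sums mat_vec V (mat_exp V M) f u"
    unfolding mat_vec_def by (intro sums_sum sums_mult2 sums_mat_exp assms)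
  moreover have "(\<Sum>v\<in>V. mat_power V M k u v / fact k * f v) = c ^ k /\<^sub>R fact k * f u" for k
  proof -
    have "(\<Sum>v\<in>V. mat_power V M k u v / fact k * f v) = mat_vec V (mat_power V M k) f u / fact k"
      by (simp add: mat_vec_def sum_divide_distrib)
    then show ?thesis
      using mat_power_eigenvector[OF assms, of k] by (simp add: scaleR_conv_of_real divide_inverse mult_ac)
  qed
  moreover have "(\<lambda>k. c ^ k /\<^sub>R fact k * f u) sums (exp c * f u)"
    by (intro sums_mult2 exp_converges)
  ultimately show ?thesis by (simp add: sums_unique2)
qed

lemma mat_vec_add: "mat_vec V M (\<lambda>v. f v + g v) u = mat_vec V M f u + mat_vec V M g u"
  by (simp add: mat_vec_def distrib_left sum.distrib)

lemma mat_vec_scale: "mat_vec V M (\<lambda>v. c * f v) u = c * mat_vec V M f u"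
  by (simp add: mat_vec_def sum_distrib_left mult_ac)

lemma mat_vec_scale_matrix: "mat_vec V (\<lambda>v w. c * M v w) f u = c * mat_vec V M f u"
  by (simp add: mat_vec_def sum_distrib_left mult_ac)

lemma exp_half_pi_i: "exp (\<i> * of_real (pi / 2)) = \<i>"
  by (metis cis_conv_exp cis_pi_half)

text \<open>Adding 4m to the eigenvalue changes the exponent by a multiple of 2 pi i. The nested
  form of the argument anticipates an eigenvalue \<open>2 * m\<close> of the sum over the
  unipotents, counted once for U and once for -U.\<close>

lemma exp_neg_half_pi_i_odd: "exp (- \<i> * of_real (pi / 2) * (1 + 2 * (2 * of_int m))) = - \<i>"
proof -
  have "- \<i> * of_real (pi / 2) * (1 + 2 * (2 * of_int m)) =
    - (\<i> * of_real (pi / 2)) + (2 * of_int (- m) * pi) * \<i>"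
    by (simp add: algebra_simps)
  also have "exp \<dots> = exp (- (\<i> * of_real (pi / 2)))"
    unfolding exp_add by (subst exp_integer_2pi) auto
  also have "\<dots> = - \<i>"
    unfolding exp_minus exp_half_pi_i by simp
  finally show ?thesis .
qed

section \<open>Unipotent two-by-two matrices\<close>

lemma vec2_eq_iff: "(x :: 'a ^ 2) = y \<longleftrightarrow> x$1 = y$1 \<and> x$2 = y$2"
  by (simp add: vec_eq_iff forall_2)

lemma mat2_eq_iff:
  "(A :: 'a ^ 2 ^ 2) = B \<longleftrightarrow> A$1$1 = B$1$1 \<and> A$1$2 = B$1$2 \<and> A$2$1 = B$2$1 \<and> A$2$2 = B$2$2"
  by (auto simp: vec2_eq_iff)

lemma mat2_mult_vec_nth: "((A :: 'a::semiring_1 ^ 2 ^ 2) *v x) $ i = A$i$1 * x$1 + A$i$2 * x$2"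
  by (simp add: matrix_vector_mult_def sum_2)

lemma mat2_mult_nth: "((A :: 'a::semiring_1 ^ 2 ^ 2) ** B) $ i $ j = A$i$1 * B$1$j + A$i$2 * B$2$j"
  by (simp add: matrix_matrix_mult_def sum_2)

lemma trace2: "trace (A :: 'a::comm_semiring_1 ^ 2 ^ 2) = A$1$1 + A$2$2"
  by (simp add: trace_def sum_2)

lemma mat2_one_nth [simp]:
  "(mat 1 :: 'a::zero_neq_one ^ 2 ^ 2)$1$1 = 1" "(mat 1 :: 'a ^ 2 ^ 2)$1$2 = 0"
  "(mat 1 :: 'a ^ 2 ^ 2)$2$1 = 0" "(mat 1 :: 'a ^ 2 ^ 2)$2$2 = 1"
  by (simp_all add: mat_def)

lemmas mat2_simps = vec2_eq_iff mat2_eq_iff mat2_mult_vec_nth mat2_mult_nth trace2 det_2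

lemma det_uminus_2: "det (- A :: 'a::comm_ring_1 ^ 2 ^ 2) = det A"
  by (simp add: det_2)

lemma uminus_mat2_mult: "- (A :: 'a::comm_ring_1 ^ 2 ^ 2) ** (B :: 'a ^ 2 ^ 2) = - (A ** B)"
  unfolding mat2_eq_iff by (simp add: mat2_mult_nth)

lemma mat2_mult_uminus: "(A :: 'a::comm_ring_1 ^ 2 ^ 2) ** - (B :: 'a ^ 2 ^ 2) = - (A ** B)"
  unfolding mat2_eq_iff by (simp add: mat2_mult_nth)

text \<open>This is the characteristic polynomial at 1: for determinant 1, the trace is 2 exactly
  when 1 is an eigenvalue.\<close>

lemma det_minus_one_2: "det (A - mat 1 :: 'a::comm_ring_1 ^ 2 ^ 2) = det A + 1 - trace A"
  by (simp add: mat2_simps algebra_simps)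

lemma mat_mult_vec_eq_0:
  fixes A :: "'a::field ^ 'n ^ 'n"
  assumes "det A \<noteq> 0" "A *v x = 0"
  shows "x = 0"
  using assms by (metis inj_matrix_vector_mult invertible_det_nz injD matrix_vector_mult_0_right)

definition unipotents :: "('a::field ^ 2 ^ 2) set" where
  "unipotents = {u. det u = 1 \<and> trace u = 2 \<and> u \<noteq> mat 1}"

text \<open>The determinant with columns \<open>x\<close> and \<open>y\<close>, used as a test for
  linear dependence.\<close>

definition wedge :: "'a::field ^ 2 \<Rightarrow> 'a ^ 2 \<Rightarrow> 'a" where
  "wedge x y = x$1 * y$2 - x$2 * y$1"

lemma wedge_eq_0_iff:
  assumes "z \<noteq> 0"
  shows "wedge z w = 0 \<longleftrightarrow> (\<exists>c. w = c *s z)"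
proof
  assume 0: "wedge z w = 0"
  have "z$1 \<noteq> 0 \<or> z$2 \<noteq> 0" using assms by (auto simp: vec2_eq_iff)
  then show "\<exists>c. w = c *s z"
  proof
    assume "z$1 \<noteq> 0"
    then have "w = (w$1 / z$1) *s z" using 0 by (auto simp: vec2_eq_iff wedge_def field_simps)
    then show ?thesis ..
  next
    assume "z$2 \<noteq> 0"
    then have "w = (w$2 / z$2) *s z" using 0 by (auto simp: vec2_eq_iff wedge_def field_simps)
    then show ?thesis ..
  qed
qed (auto simp: wedge_def)

lemma mat2_eqI_wedge:
  fixes A :: "'a::field ^ 2 ^ 2"
  assumes "wedge z w \<noteq> 0" "A *v z = B *v z" "A *v w = B *v w"
  shows "A = B"
proof -
  have "A$i$1 = B$i$1 \<and> A$i$2 = B$i$2" for i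
  proof -
    have z: "(A$i$1 - B$i$1) * z$1 + (A$i$2 - B$i$2) * z$2 = 0"
      using arg_cong[OF assms(2), of "\<lambda>x. x$i"] by (simp add: mat2_mult_vec_nth algebra_simps)
    have w: "(A$i$1 - B$i$1) * w$1 + (A$i$2 - B$i$2) * w$2 = 0"
      using arg_cong[OF assms(3), of "\<lambda>x. x$i"] by (simp add: mat2_mult_vec_nth algebra_simps)
    \<comment> \<open>Cramer's rule, to be applied to row \<open>i\<close> of \<open>A - B\<close>,
      which annihilates the basis \<open>z\<close>, \<open>w\<close>.\<close>
    have "(a * z$1 + b * z$2) * w$2 - (a * w$1 + b * w$2) * z$2 = a * wedge z w"
      "(a * w$1 + b * w$2) * z$1 - (a * z$1 + b * z$2) * w$1 = b * wedge z w" for a b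
      by (simp_all add: wedge_def algebra_simps)
    from this[of "A$i$1 - B$i$1" "A$i$2 - B$i$2"]
    have "(A$i$1 - B$i$1) * wedge z w = 0" "(A$i$2 - B$i$2) * wedge z w = 0"
      unfolding z w by simp_all
    then show ?thesis using assms(1) by simp
  qed
  then show ?thesis by (simp add: mat2_eq_iff)
qed

text \<open>The row vector \<open>[- y$2, y$1]\<close> represents \<open>wedge y\<close>, so the
  matrix moves each vector by a multiple of \<open>y\<close> and fixes the line of \<open>y\<close>
  pointwise.\<close>

definition transvection :: "'a::field ^ 2 \<Rightarrow> 'a \<Rightarrow> 'a ^ 2 ^ 2" where
  "transvection y s = mat 1 + (\<chi> i. (s * y$i) *s vector [- y$2, y$1])"

lemma transvection_nth:
  "transvection y s $1$1 = 1 - s * y$1 * y$2" "transvection y s $1$2 = s * y$1 * y$1"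
  "transvection y s $2$1 = - s * y$2 * y$2" "transvection y s $2$2 = 1 + s * y$1 * y$2"
  by (simp_all add: transvection_def)

lemma transvection_mult_vec: "transvection y s *v x = x + (s * wedge y x) *s y"
  by (simp add: mat2_simps transvection_nth wedge_def algebra_simps)

lemma transvection_in_unipotents:
  assumes "y \<noteq> 0" "s \<noteq> 0"
  shows "transvection y s \<in> unipotents"
  using assms unfolding unipotents_def
  by (auto simp: mat2_simps transvection_nth algebra_simps)

lemma Cayley_Hamilton_2:
  "(A :: 'a::comm_ring_1 ^ 2 ^ 2) *v (A *v x) = trace A *s (A *v x) - det A *s x"
  by (simp add: mat2_simps algebra_simps)

lemma unipotents_Cayley_Hamilton:
  assumes "u \<in> unipotents"
  shows "u *v (u *v x) = 2 *s (u *v x) - x"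
  using assms Cayley_Hamilton_2[of u x] by (simp add: unipotents_def)

text \<open>If \<open>u\<close> fixes \<open>z\<close> and has trace 2, then
  \<open>u - mat 1\<close> kills \<open>z\<close> and has trace 0, which leaves a single free
  parameter \<open>s\<close>. The identity is the case \<open>s = 0\<close>.\<close>

lemma unipotents_fixing_eq:
  assumes "z \<noteq> (0 :: 'a::field ^ 2)"
  shows "{u \<in> unipotents. u *v z = z} = transvection z ` (- {0})"
proof (intro equalityI subsetI)
  fix u assume "u \<in> {u \<in> unipotents. u *v z = z}"
  then have uz: "u *v z = z" and t: "u$1$1 + u$2$2 = 2" and u1: "u \<noteq> mat 1"
    by (auto simp: unipotents_def trace2)
  have e1: "(u$1$1 - 1) * z$1 = - u$1$2 * z$2" and e2: "u$2$1 * z$1 = - (u$2$2 - 1) * z$2"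
    using uz by (simp_all add: mat2_simps algebra_simps eq_diff_eq)
  have "\<exists>s. u = transvection z s"
  proof (cases "z$1 = 0")
    case False
    have u11: "u$1$1 - 1 = - u$1$2 * z$2 / z$1" using e1 False by (simp add: field_simps)
    have "u$2$2 = 2 - u$1$1" using t by (simp add: eq_diff_eq add.commute)
    then have "u$2$2 - 1 = - (u$1$1 - 1)" by simp
    then have u22: "u$2$2 - 1 = u$1$2 * z$2 / z$1" unfolding u11 by simp
    have u21: "u$2$1 = - u$1$2 * z$2 * z$2 / (z$1 * z$1)"
      using e2 False unfolding u22 by (simp add: field_simps)
    \<comment> \<open>The parameter is read off from the entry \<open>s * z$1 * z$1\<close> in
      position (1,2).\<close>
    have "u = transvection z (u$1$2 / (z$1 * z$1))"
      using u11 u22 u21 False by (simp add: mat2_eq_iff transvection_nth diff_eq_eq)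
    then show ?thesis ..
  next
    case True
    then have z2: "z$2 \<noteq> 0" using assms by (auto simp: vec2_eq_iff)
    then have "u$1$2 = 0" "u$2$2 = 1" "u$1$1 = 1" using e1 e2 True t by auto
    \<comment> \<open>Here the only entry that still determines \<open>s\<close> is
      \<open>- s * z$2 * z$2\<close> in position (2,1).\<close>
    then have "u = transvection z (- u$2$1 / (z$2 * z$2))"
      using True z2 by (simp add: mat2_simps transvection_nth)
    then show ?thesis ..
  qed
  moreover have "transvection z 0 = mat 1" by (simp add: mat2_simps transvection_nth)
  ultimately show "u \<in> transvection z ` (- {0})" using u1 by auto
next
  fix u assume "u \<in> transvection z ` (- {0})"
  then obtain s where "s \<noteq> 0" "u = transvection z s" by auto
  then show "u \<in> {u \<in> unipotents. u *v z = z}"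
    using assms by (simp add: transvection_in_unipotents transvection_mult_vec wedge_def)
qed

lemma inj_transvection:
  assumes "z \<noteq> (0 :: 'a::field ^ 2)"
  shows "inj (transvection z)"
proof (rule injI)
  fix s s' assume "transvection z s = transvection z s'"
  then show "s = s'" using assms by (auto simp: mat2_simps transvection_nth)
qed

text \<open>A transvection along \<open>w - z\<close> exists. It is unique because Cayley-Hamilton
  forces \<open>w\<close> to go to \<open>2 *s w - z\<close>, so the images of the basis
  \<open>z\<close>, \<open>w\<close> are prescribed.\<close>

lemma unipotents_mapping_wedge:
  assumes "wedge z w \<noteq> (0 :: 'a::field)"
  shows "\<exists>u. {u \<in> unipotents. u *v z = w} = {u}"
proof -
  have wz: "wedge (w - z) z \<noteq> 0" using assms by (simp add: wedge_def algebra_simps)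
  \<comment> \<open>The scalar is normalised so that \<open>z\<close> is moved by exactly
    \<open>w - z\<close>.\<close>
  define u where "u = transvection (w - z) (1 / wedge (w - z) z)"
  have "w - z \<noteq> 0" using wz by (auto simp: wedge_def)
  then have u: "u \<in> unipotents" unfolding u_def using wz by (simp add: transvection_in_unipotents)
  have uz: "u *v z = w" unfolding u_def transvection_mult_vec using wz by simp
  have "v = u" if v: "v \<in> unipotents" "v *v z = w" for v
  proof (rule mat2_eqI_wedge[OF assms])
    show "v *v z = u *v z" using uz v by simp
    show "v *v w = u *v w"
      using unipotents_Cayley_Hamilton[OF u, of z] unipotents_Cayley_Hamilton[OF v(1), of z] uz v(2)
      by simp
  qed
  then show ?thesis using u uz by blast
qed

text \<open>The square of \<open>u - mat 1\<close> is zero, so 1 is the only possible eigenvalue;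
  \<open>c = 0\<close> is covered as well.\<close>

lemma unipotents_mapping_scaled:
  assumes "z \<noteq> (0 :: 'a::field ^ 2)" "c \<noteq> 1"
  shows "{u \<in> unipotents. u *v z = c *s z} = {}"
proof -
  { fix u assume u: "u \<in> unipotents" "u *v z = c *s z"
    have "u *v (c *s z) = c *s (u *v z)" by (simp add: mat2_simps algebra_simps)
    then have "((c - 1) * (c - 1)) *s z = 0"
      using unipotents_Cayley_Hamilton[OF u(1), of z] u(2) by (simp add: vec2_eq_iff algebra_simps)
    then have False using assms by (simp add: vector_mul_eq_0) }
  then show ?thesis by blast
qed

lemma card_unipotents_mapping:
  assumes "z \<noteq> (0 :: 'a::{field,finite} ^ 2)"
  shows "card {u \<in> unipotents. u *v z = w} =
    (if w = z then CARD('a) - 1 else if wedge z w = 0 then 0 else 1)"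
proof (cases "wedge z w = 0")
  case True
  then obtain c where c: "w = c *s z" using wedge_eq_0_iff[OF assms] by blast
  show ?thesis
  proof (cases "w = z")
    case True
    have "card {u \<in> unipotents. u *v z = z} = card (- {0 :: 'a})"
      unfolding unipotents_fixing_eq[OF assms]
      by (rule card_image) (rule inj_on_subset[OF inj_transvection[OF assms] subset_UNIV])
    then show ?thesis using True by (simp add: Compl_eq_Diff_UNIV card_Diff_singleton)
  next
    case False
    then have "c \<noteq> 1" using c by auto
    then show ?thesis using unipotents_mapping_scaled[OF assms] c False True by simp
  qed
next
  case False
  then have "w \<noteq> z" by (auto simp: wedge_def)
  moreover obtain u where "{u \<in> unipotents. u *v z = w} = {u}"
    using unipotents_mapping_wedge[OF False] by blast
  ultimately show ?thesis using False by simp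
qed

section \<open>Elements of order p and 2p\<close>

text \<open>The traces 2 and -2 will separate the unipotents from their negatives.\<close>

lemma two_neq_minus_two:
  assumes "(2 :: 'a::field) \<noteq> 0"
  shows "2 \<noteq> (- 2 :: 'a)"
proof
  assume "2 = (- 2 :: 'a)"
  then have "(2 :: 'a) * 2 = 0" by (metis add_eq_0_iff mult_2)
  then show False using assms by (metis mult_eq_0_iff)
qed

text \<open>Translation by 1 permutes the ring, so it preserves the sum of all elements while adding
  the cardinality to it.\<close>

lemma of_nat_CARD_eq_0: "of_nat CARD('a) = (0 :: 'a::{ring_1,finite})"
proof -
  have "(\<Sum>x\<in>UNIV. x) = (\<Sum>x\<in>(UNIV :: 'a set). x + 1)"
    by (rule sum.reindex_bij_witness[of _ "\<lambda>x. x + 1" "\<lambda>x. x - 1"]) auto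
  then show ?thesis by (simp add: sum.distrib)
qed

section \<open>Matrix powers in characteristic p\<close>

lemma mat_vec_sum_right: "(A :: 'a::comm_semiring_1 ^ 'n ^ 'm) *v (\<Sum>i\<in>I. f i) = (\<Sum>i\<in>I. A *v f i)"
  by (induction I rule: infinite_finite_induct) (simp_all add: matrix_vector_right_distrib)

text \<open>The binomial theorem for the identity plus \<open>N\<close>. Powers are iterated maps on
  vectors, since \<open>*\<close> and \<open>^\<close> act componentwise on this matrix
  type.\<close>

lemma matrix_funpow_binomial:
  fixes A N :: "'a::field ^ 'n ^ 'n"
  assumes "A = mat 1 + N"
  shows "((*v) A ^^ k) x = (\<Sum>j\<le>k. of_nat (k choose j) *s ((*v) N ^^ j) x)"
proof (induction k)
  case (Suc k)
  let ?h = "\<lambda>j. ((*v) N ^^ j) x"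
  have A: "A *v y = y + N *v y" for y
    by (simp add: assms matrix_vector_mult_add_rdistrib matrix_vector_mul_lid)
  \<comment> \<open>A vanishing top term is added and the term \<open>j = 0\<close> split off, so
    that Pascal's rule can be applied term by term.\<close>
  have "(\<Sum>j\<le>k. of_nat (k choose j) *s ?h j) = (\<Sum>j\<le>Suc k. of_nat (k choose j) *s ?h j)"
    by (simp add: binomial_eq_0)
  also have "\<dots> = x + (\<Sum>j\<le>k. of_nat (k choose Suc j) *s ?h (Suc j))"
    by (subst sum.atMost_Suc_shift) simp
  finally have 1: "(\<Sum>j\<le>k. of_nat (k choose j) *s ?h j) =
    x + (\<Sum>j\<le>k. of_nat (k choose Suc j) *s ?h (Suc j))" .
  have "((*v) A ^^ Suc k) x = (\<Sum>j\<le>k. of_nat (k choose j) *s ?h j) +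
      (\<Sum>j\<le>k. of_nat (k choose j) *s ?h (Suc j))"
    by (simp add: Suc.IH A mat_vec_sum_right vector_scalar_commute sum.distrib)
  also have "\<dots> = x + (\<Sum>j\<le>k. of_nat (Suc k choose Suc j) *s ?h (Suc j))"
    unfolding 1 by (simp add: sum.distrib[symmetric] vector_sadd_rdistrib add_ac)
  also have "\<dots> = (\<Sum>j\<le>Suc k. of_nat (Suc k choose j) *s ?h j)"
    by (subst sum.atMost_Suc_shift) simp
  finally show ?case .
qed simp

text \<open>The Frobenius identity: \<open>p\<close> divides all binomial coefficients except the
  two outer ones.\<close>

lemma matrix_funpow_prime:
  fixes A :: "'a::field ^ 'n ^ 'n"
  assumes "prime p" "of_nat p = (0 :: 'a)"
  shows "((*v) A ^^ p) x = x + ((*v) (A - mat 1) ^^ p) x"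
proof -
  have "p > 0" using assms(1) by (simp add: prime_gt_0_nat)
  have 0: "of_nat (p choose j) = (0 :: 'a)" if "0 < j" "j < p" for j
  proof -
    have "p dvd p choose j" using that assms(1) \<open>p > 0\<close> by (intro dvd_choose_prime) auto
    then obtain m where "p choose j = p * m" by (rule dvdE)
    then show ?thesis using assms(2) by simp
  qed
  have "((*v) A ^^ p) x = (\<Sum>j\<le>p. of_nat (p choose j) *s ((*v) (A - mat 1) ^^ j) x)"
    by (rule matrix_funpow_binomial) simp
  also have "\<dots> = (\<Sum>j\<in>{0, p}. of_nat (p choose j) *s ((*v) (A - mat 1) ^^ j) x)"
    by (rule sum.mono_neutral_right) (auto simp: 0)
  finally show ?thesis using \<open>p > 0\<close> by simp
qed

lemma carrier_SL: "carrier SL = {A. det A = 1}"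
  and mult_SL: "A \<otimes>\<^bsub>SL\<^esub> B = A ** B"
  and one_SL: "\<one>\<^bsub>SL\<^esub> = mat 1"
  by (simp_all add: SL_def)

lemma SL_pow_mult_vec: "(A [^]\<^bsub>SL\<^esub> (k :: nat)) *v x = ((*v) A ^^ k) x"
proof (induction k arbitrary: x)
  case 0
  then show ?case by (simp add: one_SL nat_pow_def matrix_vector_mul_lid)
next
  case (Suc k)
  have "A [^]\<^bsub>SL\<^esub> Suc k = (A [^]\<^bsub>SL\<^esub> k) ** A" by (simp add: nat_pow_def mult_SL)
  then show ?case using Suc by (simp add: matrix_vector_mul_assoc[symmetric] funpow_swap1)
qed

text \<open>By the Frobenius identity, \<open>A\<close> has trivial \<open>p\<close>-th power
  exactly when \<open>A - mat 1\<close> is nilpotent with vanishing \<open>p\<close>-th power. For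
  determinant 1 this amounts to the eigenvalue 1, that is, to trace 2.\<close>

lemma SL_pow_prime_eq_one_iff:
  fixes A :: "'a::field ^ 2 ^ 2"
  assumes "prime p" "of_nat p = (0 :: 'a)" "det A = 1"
  shows "A [^]\<^bsub>SL\<^esub> p = mat 1 \<longleftrightarrow> trace A = 2"
proof
  let ?N = "A - mat 1"
  assume "A [^]\<^bsub>SL\<^esub> p = mat 1"
  then have "((*v) A ^^ p) x = x" for x
    using SL_pow_mult_vec[of A p x] by (simp add: matrix_vector_mul_lid)
  then have N0: "((*v) ?N ^^ p) x = 0" for x
    using matrix_funpow_prime[OF assms(1,2), of A x] by simp
  have "det ?N = 0"
  proof (rule ccontr)
    assume "det ?N \<noteq> 0"
    \<comment> \<open>An invertible matrix has injective powers, whereas the \<open>p\<close>-th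
      power of \<open>?N\<close> kills every vector, in particular the all-ones vector
      \<open>1\<close>.\<close>
    then have "x = 0" if "((*v) ?N ^^ k) x = 0" for k x
      using that by (induction k) (auto dest: mat_mult_vec_eq_0)
    from this[OF N0] have "(1 :: 'a ^ 2) = 0" by blast
    then show False by simp
  qed
  then show "trace A = 2" using assms(3) by (simp add: det_minus_one_2)
next
  assume tr: "trace A = 2"
  show "A [^]\<^bsub>SL\<^esub> p = mat 1"
  proof (cases "A = mat 1")
    case True
    then show ?thesis using monoid.nat_pow_one[OF group.is_monoid[OF group_SL]] by (simp add: one_SL)
  next
    case False
    then have u: "A \<in> unipotents" using assms tr by (simp add: unipotents_def)
    \<comment> \<open>A prime is at least 2, and two factors \<open>A - mat 1\<close> already give
      zero.\<close>
    obtain m where p: "p = Suc (Suc m)"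
      using prime_ge_2_nat[OF assms(1)] by (metis add_2_eq_Suc le_Suc_ex)
    have N: "(A - mat 1) *v ((A - mat 1) *v x) = 0" for x
      using unipotents_Cayley_Hamilton[OF u, of x]
      by (simp add: matrix_vector_mult_diff_rdistrib matrix_vector_mult_diff_distrib
          matrix_vector_mul_lid vec2_eq_iff)
    have "((*v) (A - mat 1) ^^ k) 0 = 0" for k by (induction k) auto
    then have "((*v) (A - mat 1) ^^ p) x = 0" for x
      using N unfolding p by (simp add: funpow_swap1)
    then have "(A [^]\<^bsub>SL\<^esub> p) *v x = mat 1 *v x" for x
      using matrix_funpow_prime[OF assms(1,2), of A x]
      by (simp add: SL_pow_mult_vec matrix_vector_mul_lid)
    then show ?thesis by (simp add: matrix_eq)
  qed
qed

lemma ord_SL_eq_prime_iff: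
  fixes A :: "'a::field ^ 2 ^ 2"
  assumes "prime p" "of_nat p = (0 :: 'a)" "det A = 1"
  shows "group.ord SL A = p \<longleftrightarrow> A \<in> unipotents"
proof -
  interpret group "SL :: ('a ^ 2 ^ 2) monoid" by (rule group_SL)
  have A: "A \<in> carrier SL" using assms by (simp add: carrier_SL)
  have p: "A [^]\<^bsub>SL\<^esub> p = mat 1 \<longleftrightarrow> ord A dvd p" using pow_eq_id[OF A] by (simp add: one_SL)
  have 1: "ord A = 1 \<longleftrightarrow> A = mat 1" using ord_eq_1[OF A] by (simp add: one_SL)
  have "p \<noteq> 1" using assms(1) by auto
  then have "ord A = p \<longleftrightarrow> ord A dvd p \<and> ord A \<noteq> 1"
    using assms(1) by (auto simp: prime_nat_iff)
  then show ?thesis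
    using p 1 SL_pow_prime_eq_one_iff[OF assms] assms(3) by (auto simp: unipotents_def)
qed

lemma SL_pow_uminus:
  "(- A :: 'a::field ^ 2 ^ 2) [^]\<^bsub>SL\<^esub> (k :: nat) = (if even k then A [^]\<^bsub>SL\<^esub> k else - (A [^]\<^bsub>SL\<^esub> k))"
  by (induction k) (auto simp: nat_pow_def mult_SL uminus_mat2_mult mat2_mult_uminus)

text \<open>Applying the order-\<open>p\<close> criterion to the square of \<open>A\<close> gives
  trace 2 or -2. Trace 2 would already make the \<open>p\<close>-th power trivial, so order
  \<open>2 * p\<close> belongs to trace -2, with \<open>A = - mat 1\<close> excluded.\<close>

lemma ord_SL_eq_twice_prime_iff:
  fixes A :: "'a::field ^ 2 ^ 2"
  assumes "prime p" "odd p" "of_nat p = (0 :: 'a)" "(2 :: 'a) \<noteq> 0" "det A = 1"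
  shows "group.ord SL A = 2 * p \<longleftrightarrow> - A \<in> unipotents"
proof -
  interpret group "SL :: ('a ^ 2 ^ 2) monoid" by (rule group_SL)
  have A: "A \<in> carrier SL" "- A \<in> carrier SL" using assms by (simp_all add: carrier_SL det_uminus_2)
  have dvd: "A [^]\<^bsub>SL\<^esub> k = mat 1 \<longleftrightarrow> ord A dvd k" "- A [^]\<^bsub>SL\<^esub> k = mat 1 \<longleftrightarrow> ord (- A) dvd k" for k
    using pow_eq_id A by (simp_all add: one_SL)
  have p: "p > 1" using assms(1) prime_gt_1_nat by blast
  have sq: "A [^]\<^bsub>SL\<^esub> (2 :: nat) = A ** A"
    by (simp add: numeral_2_eq_2 nat_pow_def mult_SL one_SL)
  have sqp: "A [^]\<^bsub>SL\<^esub> (2 * p) = (A ** A) [^]\<^bsub>SL\<^esub> p"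
    using nat_pow_pow[OF A(1), of 2 p] by (simp add: sq)
  have pow2p: "A [^]\<^bsub>SL\<^esub> (2 * p) = mat 1 \<longleftrightarrow> trace (A ** A) = 2"
    unfolding sqp using SL_pow_prime_eq_one_iff[OF assms(1,3)] assms(5) by (simp add: det_mul)
  have trsq: "trace (A ** A) = trace A * trace A - 2"
    using assms(5) by (simp add: mat2_simps algebra_simps)
  have tr_neg: "trace (- A) = - trace A" by (simp add: trace2)
  show ?thesis
  proof
    assume ord: "ord A = 2 * p"
    then have "trace (A ** A) = 2" using pow2p dvd(1)[of "2 * p"] by simp
    then have "(trace A - 2) * (trace A + 2) = 0" unfolding trsq by (simp add: algebra_simps)
    moreover have "trace A \<noteq> 2"
    proof
      assume "trace A = 2"
      then have "2 * p dvd p" using SL_pow_prime_eq_one_iff[OF assms(1,3,5)] dvd(1)[of p] ord by simp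
      then show False using p by (auto dest: dvd_imp_le)
    qed
    ultimately have "trace (- A) = 2" unfolding tr_neg by (simp add: add_eq_0_iff2)
    moreover have "- A \<noteq> mat 1"
    proof
      assume "- A = mat 1"
      then have "A = - mat 1" by (metis minus_minus)
      then have "A [^]\<^bsub>SL\<^esub> (2 :: nat) = mat 1"
        unfolding sq by (simp add: mat2_eq_iff mat2_mult_nth)
      then have "2 * p dvd 2" using dvd(1) ord by metis
      then show False using p by (auto dest: dvd_imp_le)
    qed
    ultimately show "- A \<in> unipotents" using assms(5) by (simp add: unipotents_def det_uminus_2)
  next
    assume u: "- A \<in> unipotents"
    then have tr: "trace (- A) = 2" and "- A [^]\<^bsub>SL\<^esub> p = mat 1" and A1: "- A \<noteq> mat 1"
      using SL_pow_prime_eq_one_iff[OF assms(1,3), of "- A"] by (auto simp: unipotents_def)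
    have "trace A = - 2" using tr unfolding tr_neg by (metis minus_minus)
    then have "ord A dvd 2 * p" using pow2p dvd(1)[of "2 * p"] by (simp add: trsq)
    moreover have "\<not> ord A dvd p"
    proof -
      show ?thesis
        using two_neq_minus_two[OF assms(4)] SL_pow_prime_eq_one_iff[OF assms(1,3,5)] dvd(1)[of p]
          \<open>trace A = - 2\<close> by simp
    qed
    moreover have "ord A \<noteq> 2"
    proof
      assume "ord A = 2"
      \<comment> \<open>\<open>A\<close> and \<open>- A\<close> have the same square, so the order
        of \<open>- A\<close> would divide both 2 and the odd \<open>p\<close>, making
        \<open>- A\<close> trivial.\<close>
      then have "ord (- A) dvd 2" using dvd[of 2] SL_pow_uminus[of A 2] by simp
      moreover have "ord (- A) dvd p" using dvd(2) \<open>- A [^]\<^bsub>SL\<^esub> p = mat 1\<close> by blast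
      ultimately have "ord (- A) = 1"
        using assms(2) by (metis coprime_common_divisor_nat coprime_left_2_iff_odd)
      then show False using ord_eq_1[OF A(2)] A1 by (simp add: one_SL)
    qed
    moreover have "even (ord A)"
    proof (rule ccontr)
      assume "odd (ord A)"
      then have "coprime (ord A) 2" by simp
      \<comment> \<open>Among the facts collected so far, \<open>ord A\<close> divides
        \<open>2 * p\<close> but not \<open>p\<close>; an odd order would have to divide
        \<open>p\<close>.\<close>
      then show False using calculation by (simp add: coprime_dvd_mult_right_iff)
    qed
    then obtain m where m: "ord A = 2 * m" by (rule evenE)
    ultimately have "m dvd p" "m \<noteq> 1" by auto
    then show "ord A = 2 * p" using assms(1) m by (auto simp: prime_nat_iff)
  qed
qed

section \<open>Left translation by the sum of the unipotents\<close>

text \<open>On functions on the group, this is the adjacency operator of the Cayley graph with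
  connection set \<open>unipotents\<close>. It commutes with right translations, so test functions
  may be centred at any \<open>a\<close>.\<close>

definition unipotent_sum :: "('a::{field,finite} ^ 2 ^ 2 \<Rightarrow> complex) \<Rightarrow> 'a ^ 2 ^ 2 \<Rightarrow> complex" where
  "unipotent_sum f g = (\<Sum>u\<in>unipotents. f (u ** g))"

text \<open>
  Right translates by \<open>a\<inverse>\<close> of the permutation characters of \<open>SL(2, q)\<close> on nonzero vectors (\<open>d = 1\<close>)
  and, up to the factor \<open>q - 1\<close>, on the projective line (the sum over \<open>d\<close>).  Keeping \<open>a\<close> on the right-hand
  side avoids the inverse.
\<close>

definition scaled_agreements :: "'a::{field,finite} ^ 2 ^ 2 \<Rightarrow> 'a \<Rightarrow> 'a ^ 2 ^ 2 \<Rightarrow> complex" where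
  "scaled_agreements a d g = (\<Sum>w\<in>- {0}. of_bool (g *v w = d *s (a *v w)))"

definition projective_agreements :: "'a::{field,finite} ^ 2 ^ 2 \<Rightarrow> 'a ^ 2 ^ 2 \<Rightarrow> complex" where
  "projective_agreements a g = (\<Sum>d\<in>- {0}. scaled_agreements a d g)"

section \<open>Counting nonzero vectors and unipotents\<close>

lemma card_nonzero_vec2: "card (- {0 :: 'a::{field,finite} ^ 2}) = CARD('a) ^ 2 - 1"
  by (simp add: Compl_eq_Diff_UNIV card_Diff_singleton)

lemma CARD_ge_1: "CARD('a::finite) \<ge> 1"
  by (simp add: Suc_le_eq)

lemma of_nat_card_nonzero_vec2:
  "of_nat (card (- {0 :: 'a::{field,finite} ^ 2})) = (of_nat CARD('a) ^ 2 - 1 :: complex)"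
  unfolding card_nonzero_vec2 by (subst of_nat_diff) (auto simp: CARD_ge_1)

lemma of_nat_card_nonzero:
  "of_nat (card (- {0 :: 'a::{field,finite}})) = (of_nat CARD('a) - 1 :: complex)"
  by (simp add: Compl_eq_Diff_UNIV card_Diff_singleton of_nat_diff CARD_ge_1)

lemma sum_of_bool_scale_eq:
  assumes "z \<noteq> 0" "w \<noteq> (0 :: 'a::{field,finite} ^ 2)"
  shows "(\<Sum>e\<in>- {0}. of_bool (z = e *s w)) = (of_bool (wedge z w = 0) :: complex)"
proof (cases "wedge z w = 0")
  case True
  then have "wedge w z = 0" by (simp add: wedge_def algebra_simps)
  then obtain c where c: "z = c *s w" using wedge_eq_0_iff[OF assms(2)] by blast
  then have "c \<noteq> 0" using assms(1) by auto
  have "(\<Sum>e\<in>- {0}. of_bool (z = e *s w)) = (\<Sum>e\<in>- {0}. if e = c then 1 else 0 :: complex)"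
    using assms(2) by (intro sum.cong) (auto simp: c vector_mul_rcancel)
  then show ?thesis using True \<open>c \<noteq> 0\<close> by simp
next
  case False
  have "z \<noteq> e *s w" for e
  proof
    assume "z = e *s w"
    then have "wedge z w = 0" by (simp add: wedge_def)
    then show False using False by simp
  qed
  then show ?thesis using False by simp
qed

text \<open>The three cases of the count become one linear formula. Dependence of \<open>z\<close>
  and \<open>w\<close> is expressed as a sum over scalars, which is what later produces
  \<open>projective_agreements\<close>.\<close>

lemma sum_unipotents_mapping:
  assumes "z \<noteq> 0" "w \<noteq> (0 :: 'a::{field,finite} ^ 2)"
  shows "(\<Sum>u\<in>unipotents. of_bool (u *v z = w)) =
    (of_nat CARD('a) - 1) * of_bool (z = w) + 1 - (\<Sum>e\<in>- {0}. of_bool (z = e *s w) :: complex)"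
proof -
  have "(\<Sum>u\<in>unipotents. of_bool (u *v z = w)) = (of_nat (card {u \<in> unipotents. u *v z = w}) :: complex)"
  proof -
    have "unipotents \<inter> {u. u *v z = w} = {u \<in> unipotents. u *v z = w}" by blast
    then show ?thesis by (simp add: of_bool_def sum.If_cases)
  qed
  also have "\<dots> = (of_nat CARD('a) - 1) * of_bool (z = w) + 1 - of_bool (wedge z w = 0)"
    unfolding card_unipotents_mapping[OF assms(1)]
    by (auto simp: wedge_def of_nat_diff CARD_ge_1)
  finally show ?thesis by (simp only: sum_of_bool_scale_eq[OF assms])
qed

text \<open>Each unipotent sends a fixed \<open>z\<close> to exactly one nonzero vector, so the
  count is summed over all possible images \<open>w\<close>.\<close>

lemma card_unipotents:
  "of_nat (card (unipotents :: ('a::{field,finite} ^ 2 ^ 2) set)) = (of_nat CARD('a) ^ 2 - 1 :: complex)"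
proof -
  obtain z :: "'a ^ 2" where z: "z \<noteq> 0" by (metis zero_neq_one vec_eq_iff one_index zero_index)
  have nz: "u *v z \<noteq> 0" if "u \<in> unipotents" for u
    using mat_mult_vec_eq_0[of u z] that z by (auto simp: unipotents_def)
  have "of_nat (card (unipotents :: ('a ^ 2 ^ 2) set)) =
      (\<Sum>u\<in>(unipotents :: ('a ^ 2 ^ 2) set). \<Sum>w\<in>- {0}. of_bool (u *v z = w) :: complex)"
  proof -
    have "(\<Sum>w\<in>- {0}. of_bool (u *v z = w) :: complex) = 1" if "u \<in> unipotents" for u
      using nz[OF that] by (simp add: of_bool_def)
    then show ?thesis by simp
  qed
  also have "\<dots> = (\<Sum>w\<in>- {0}. \<Sum>u\<in>unipotents. of_bool (u *v z = w))" by (rule sum.swap)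
  also have "\<dots> = (\<Sum>w\<in>- {0}. (of_nat CARD('a) - 1) * of_bool (z = w) + 1 -
      (\<Sum>e\<in>- {0}. of_bool (z = e *s w)))"
    using z by (intro sum.cong sum_unipotents_mapping) auto
  also have "\<dots> = (of_nat CARD('a) - 1) + (of_nat CARD('a) ^ 2 - 1) -
      (\<Sum>w\<in>- {0}. \<Sum>e\<in>- {0}. of_bool (z = e *s w))"
    using z by (simp add: sum.distrib sum_subtractf sum_distrib_left[symmetric]
        of_nat_card_nonzero_vec2 of_bool_def)
  \<comment> \<open>Each nonzero scalar \<open>e\<close> determines exactly one
    \<open>w\<close>.\<close>
  also have "(\<Sum>w\<in>- {0}. \<Sum>e\<in>- {0}. of_bool (z = e *s w) :: complex) =
      (\<Sum>e\<in>- {0 :: 'a}. \<Sum>w\<in>- {0}. of_bool (w = inverse e *s z))"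
    by (subst sum.swap) (intro sum.cong arg_cong[where f = of_bool], auto simp: vec_eq_iff field_simps)
  also have "\<dots> = of_nat CARD('a) - 1"
    using z by (simp add: of_bool_def of_nat_card_nonzero vector_mul_eq_0)
  finally show ?thesis by simp
qed

section \<open>The operator on constants, agreement counts and delta functions\<close>

lemma unipotent_sum_add: "unipotent_sum (\<lambda>g. f g + h g) g = unipotent_sum f g + unipotent_sum h g"
  by (simp add: unipotent_sum_def sum.distrib)

lemma unipotent_sum_scale: "unipotent_sum (\<lambda>g. c * f g) g = c * unipotent_sum f g"
  by (simp add: unipotent_sum_def sum_distrib_left)

lemma unipotent_sum_const:
  "unipotent_sum (\<lambda>_. c :: complex) (g :: 'a::{field,finite} ^ 2 ^ 2) = (of_nat CARD('a) ^ 2 - 1) * c"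
  by (simp add: unipotent_sum_def card_unipotents)

text \<open>For each \<open>w\<close>, the count applies to the unipotents taking
  \<open>g *v w\<close> to \<open>d *s (a *v w)\<close>. The terms for proportional vectors add up
  to the projective count.\<close>

lemma unipotent_sum_scaled_agreements:
  fixes a g :: "'a::{field,finite} ^ 2 ^ 2"
  assumes "det a = 1" "det g = 1" "d \<noteq> 0"
  shows "unipotent_sum (scaled_agreements a d) g =
    (of_nat CARD('a) - 1) * scaled_agreements a d g + (of_nat CARD('a) ^ 2 - 1) - projective_agreements a g"
proof -
  have nz: "g *v w \<noteq> 0" "d *s (a *v w) \<noteq> 0" if "w \<noteq> 0" for w
    using mat_mult_vec_eq_0[of g w] mat_mult_vec_eq_0[of a w] that assms by (auto simp: vector_mul_eq_0)
  have "unipotent_sum (scaled_agreements a d) g =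
      (\<Sum>w\<in>- {0}. \<Sum>u\<in>unipotents. of_bool (u *v (g *v w) = d *s (a *v w)))"
    unfolding unipotent_sum_def scaled_agreements_def
    by (subst sum.swap) (simp add: matrix_vector_mul_assoc)
  also have "\<dots> = (\<Sum>w\<in>- {0}. (of_nat CARD('a) - 1) * of_bool (g *v w = d *s (a *v w)) + 1
      - (\<Sum>e\<in>- {0}. of_bool (g *v w = e *s (d *s (a *v w)))))"
    using nz by (intro sum.cong sum_unipotents_mapping) auto
  also have "\<dots> = (of_nat CARD('a) - 1) * scaled_agreements a d g + (of_nat CARD('a) ^ 2 - 1)
      - (\<Sum>w\<in>- {0}. \<Sum>e\<in>- {0}. of_bool (g *v w = e *s (d *s (a *v w))))"
    by (simp only: sum.distrib sum_subtractf sum_distrib_left[symmetric] scaled_agreements_def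
        sum_constant of_nat_card_nonzero_vec2 mult_1_right)
  \<comment> \<open>Since \<open>d\<close> is nonzero, \<open>e * d\<close> runs through all nonzero
    scalars.\<close>
  also have "(\<Sum>w\<in>- {0}. \<Sum>e\<in>- {0}. of_bool (g *v w = e *s (d *s (a *v w)))) = projective_agreements a g"
    unfolding projective_agreements_def scaled_agreements_def
    by (subst sum.swap, rule sum.reindex_bij_witness[of _ "\<lambda>e. e / d" "\<lambda>e. e * d"])
       (use assms in \<open>auto simp: vector_smult_assoc\<close>)
  finally show ?thesis .
qed

text \<open>Summing the previous formula over \<open>d\<close> gives q - 1 copies of the projective
  count with each sign; they cancel and leave a constant.\<close>

lemma unipotent_sum_projective_agreements:
  fixes a g :: "'a::{field,finite} ^ 2 ^ 2"
  assumes "det a = 1" "det g = 1"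
  shows "unipotent_sum (projective_agreements a) g = (of_nat CARD('a) - 1) * (of_nat CARD('a) ^ 2 - 1)"
proof -
  have "unipotent_sum (projective_agreements a) g = (\<Sum>d\<in>- {0}. unipotent_sum (scaled_agreements a d) g)"
    unfolding unipotent_sum_def projective_agreements_def by (rule sum.swap)
  also have "\<dots> = (\<Sum>d\<in>- {0}. (of_nat CARD('a) - 1) * scaled_agreements a d g +
      (of_nat CARD('a) ^ 2 - 1) - projective_agreements a g)"
    using assms by (intro sum.cong unipotent_sum_scaled_agreements) auto
  also have "\<dots> = (of_nat CARD('a) - 1) * projective_agreements a g +
      (of_nat CARD('a) - 1) * (of_nat CARD('a) ^ 2 - 1) - (of_nat CARD('a) - 1) * projective_agreements a g"
    unfolding sum.distrib sum_subtractf sum_distrib_left[symmetric] sum_constant of_nat_card_nonzero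
    by (simp add: projective_agreements_def algebra_simps)
  finally show ?thesis by simp
qed

text \<open>Since the square of \<open>u - mat 1\<close> is zero, every vector in its image is
  fixed.\<close>

lemma unipotents_fixes_nonzero:
  assumes "u \<in> unipotents"
  obtains z where "z \<noteq> 0" "u *v z = z"
proof -
  obtain x where "u *v x \<noteq> x"
    using assms matrix_eq[of u "mat 1"] by (auto simp: unipotents_def matrix_vector_mul_lid)
  moreover have "u *v (u *v x - x) = u *v x - x"
    using unipotents_Cayley_Hamilton[OF assms, of x]
    by (simp add: matrix_vector_mult_diff_distrib vec2_eq_iff algebra_simps)
  ultimately show thesis using that[of "u *v x - x"] by simp
qed

lemma unipotent_sum_delta:
  fixes a g :: "'a::{field,finite} ^ 2 ^ 2"
  assumes "det a = 1" "det g = 1"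
  shows "(of_nat CARD('a) - 1) * unipotent_sum (\<lambda>h. of_bool (h = a)) g =
    scaled_agreements a 1 g - (of_nat CARD('a) ^ 2 - 1) * of_bool (g = a)"
proof -
  have "invertible g" using assms by (simp add: invertible_det_nz)
  then obtain g' where g': "g ** g' = mat 1" "g' ** g = mat 1" by (auto simp: invertible_def)
  \<comment> \<open>This is the only matrix taking \<open>g\<close> to \<open>a\<close> from the
    left. The sum tests whether \<open>k\<close> is unipotent, and
    \<open>scaled_agreements a 1 g\<close> counts the nonzero fixed vectors of \<open>k\<close>: q^2
    - 1 for the identity, q - 1 for a unipotent, none otherwise.\<close>
  define k where "k = a ** g'"
  have kg: "k ** g = a" by (simp add: k_def matrix_mul_assoc[symmetric] g')
  have "det k = 1" using assms kg by (metis det_mul mult.right_neutral)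
  have ug: "u ** g = a \<longleftrightarrow> u = k" for u
    unfolding k_def using g' by (metis matrix_mul_assoc matrix_mul_rid)
  have ga: "g = a \<longleftrightarrow> k = mat 1" using ug[of "mat 1"] by auto
  have av: "unipotent_sum (\<lambda>h. of_bool (h = a)) g = of_bool (k \<in> unipotents)"
    unfolding unipotent_sum_def ug by (simp add: of_bool_def)
  have aw: "a *v w = k *v (g *v w)" for w
    by (simp add: kg[symmetric] matrix_vector_mul_assoc)
  have sc: "scaled_agreements a 1 g = of_nat (card {w. w \<noteq> 0 \<and> k *v (g *v w) = g *v w})"
  proof -
    have "- {0} \<inter> {w. g *v w = a *v w} = {w. w \<noteq> 0 \<and> k *v (g *v w) = g *v w}"
      by (auto simp: aw)
    then show ?thesis by (simp add: scaled_agreements_def of_bool_def sum.If_cases)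
  qed
  consider "k = mat 1" | "k \<in> unipotents" | "k \<noteq> mat 1" "trace k \<noteq> 2"
    using \<open>det k = 1\<close> by (auto simp: unipotents_def)
  then show ?thesis
  proof cases
    case 1
    then have "{w. w \<noteq> 0 \<and> k *v (g *v w) = g *v w} = - {0}" by (auto simp: matrix_vector_mul_lid)
    then have "scaled_agreements a 1 g = of_nat CARD('a) ^ 2 - 1"
      unfolding sc by (simp only: of_nat_card_nonzero_vec2)
    moreover have "k \<notin> unipotents" using 1 by (simp add: unipotents_def)
    ultimately show ?thesis unfolding av using 1 by (simp add: ga)
  next
    case 2
    then obtain z where z: "z \<noteq> 0" "k *v z = z" by (rule unipotents_fixes_nonzero)
    have k1: "k \<noteq> mat 1" using 2 by (simp add: unipotents_def)
    have gg': "g *v (g' *v x) = x" "g' *v (g *v x) = x" for x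
      by (simp_all add: matrix_vector_mul_assoc g' matrix_vector_mul_lid)
    have g'z: "g' *v z \<noteq> 0" using gg'(1)[of z] z by auto
    have "{w. w \<noteq> 0 \<and> k *v (g *v w) = g *v w} = (\<lambda>c. c *s (g' *v z)) ` (- {0})"
    proof (intro equalityI subsetI)
      fix w assume "w \<in> {w. w \<noteq> 0 \<and> k *v (g *v w) = g *v w}"
      then have w: "w \<noteq> 0" "k *v (g *v w) = g *v w" by auto
      \<comment> \<open>Two independent fixed vectors would make \<open>k\<close> the identity, so
        the fixed space is a line.\<close>
      have "wedge z (g *v w) = 0"
        using mat2_eqI_wedge[of z "g *v w" k "mat 1"] w z k1 by (auto simp: matrix_vector_mul_lid)
      then obtain c where "g *v w = c *s z" using wedge_eq_0_iff[OF z(1)] by blast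
      then have "w = c *s (g' *v z)" using gg'(2)[of w] by (simp add: vector_scalar_commute)
      then show "w \<in> (\<lambda>c. c *s (g' *v z)) ` (- {0})" using w by auto
    next
      fix w assume "w \<in> (\<lambda>c. c *s (g' *v z)) ` (- {0})"
      then obtain c where "c \<noteq> 0" "w = c *s (g' *v z)" by auto
      then show "w \<in> {w. w \<noteq> 0 \<and> k *v (g *v w) = g *v w}"
        using g'z z by (simp add: vector_scalar_commute gg' vector_mul_eq_0)
    qed
    moreover have "inj_on (\<lambda>c. c *s (g' *v z)) (- {0})"
      using g'z by (auto simp: inj_on_def vector_mul_rcancel)
    ultimately have "scaled_agreements a 1 g = of_nat CARD('a) - 1"
      unfolding sc by (simp only: card_image of_nat_card_nonzero)
    then show ?thesis unfolding av using 2 k1 by (simp add: ga)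
  next
    case 3
    have "det (k - mat 1) \<noteq> 0"
      using 3 \<open>det k = 1\<close> by (simp add: det_minus_one_2)
    have "w = 0" if "k *v (g *v w) = g *v w" for w
    proof -
      have "(k - mat 1) *v (g *v w) = 0"
        using that by (simp add: matrix_vector_mult_diff_rdistrib matrix_vector_mul_lid)
      then have "g *v w = 0" using mat_mult_vec_eq_0 \<open>det (k - mat 1) \<noteq> 0\<close> by blast
      then show ?thesis using mat_mult_vec_eq_0[of g] assms by simp
    qed
    then have "scaled_agreements a 1 g = 0" unfolding sc by auto
    moreover have "k \<notin> unipotents" using 3 by (simp add: unipotents_def)
    ultimately show ?thesis unfolding av using 3 by (simp add: ga)
  qed
qed

section \<open>The Cayley graph\<close>

lemma mat_vec_cayley_graph:
  assumes "group G" "finite (carrier G)" "T \<subseteq> carrier G" "g \<in> carrier G"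
  shows "mat_vec (carrier G) (adjacency_matrix (cayley_graph G T)) f g = (\<Sum>s\<in>T. f (s \<otimes>\<^bsub>G\<^esub> g))"
proof -
  interpret group G by fact
  have "mat_vec (carrier G) (adjacency_matrix (cayley_graph G T)) f g =
      (\<Sum>h\<in>carrier G. if h \<otimes>\<^bsub>G\<^esub> inv\<^bsub>G\<^esub> g \<in> T then f h else 0)"
    unfolding mat_vec_def
    by (rule sum.cong) (use assms in \<open>auto simp: adjacency_matrix_def cayley_graph_def\<close>)
  also have "\<dots> = (\<Sum>h\<in>{h \<in> carrier G. h \<otimes>\<^bsub>G\<^esub> inv\<^bsub>G\<^esub> g \<in> T}. f h)"
    by (rule sum.inter_filter[symmetric]) fact
  also have "\<dots> = (\<Sum>s\<in>T. f (s \<otimes>\<^bsub>G\<^esub> g))"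
    by (rule sum.reindex_bij_witness[of _ "\<lambda>s. s \<otimes>\<^bsub>G\<^esub> g" "\<lambda>h. h \<otimes>\<^bsub>G\<^esub> inv\<^bsub>G\<^esub> g"])
       (use assms in \<open>auto simp: m_assoc subset_iff\<close>)
  finally show ?thesis .
qed

text \<open>At most two unipotents carry \<open>z\<close> to \<open>k *v z\<close>. The remaining
  factor fixes \<open>z\<close> and has determinant 1, hence has trace 2.\<close>

lemma SL_eq_product_unipotents:
  assumes "det k = (1 :: 'a::field)"
  obtains a b c where "a \<in> insert (mat 1) unipotents" "b \<in> insert (mat 1) unipotents"
    "c \<in> insert (mat 1) unipotents" "k = a ** (b ** c)"
proof -
  define z :: "'a ^ 2" where "z = axis 1 1"
  have z: "z \<noteq> 0" by (simp add: z_def axis_eq_0_iff)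
  define w where "w = k *v z"
  have w: "w \<noteq> 0" using mat_mult_vec_eq_0[of k z] assms z by (auto simp: w_def)
  have 1: "\<exists>u\<in>unipotents. u *v x = y" if "wedge x y \<noteq> 0" for x y :: "'a ^ 2"
    using unipotents_mapping_wedge[OF that] by blast
  have "\<exists>a\<in>insert (mat 1) unipotents. \<exists>b\<in>unipotents. a *v (b *v z) = w"
  proof (cases "wedge z w = 0")
    case True
    \<comment> \<open>When \<open>w\<close> is a multiple of \<open>z\<close>, the passage from
      \<open>z\<close> to \<open>w\<close> goes through a vector independent of both.\<close>
    define y :: "'a ^ 2" where "y = axis 2 1"
    have "wedge z y \<noteq> 0" by (simp add: wedge_def z_def y_def axis_def)
    moreover obtain c where c: "w = c *s z" using wedge_eq_0_iff[OF z] True by blast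
    then have "wedge y w \<noteq> 0" using w by (auto simp: wedge_def z_def y_def axis_def)
    ultimately show ?thesis using 1 by blast
  next
    case False
    then obtain u where "u \<in> unipotents" "u *v z = w" using 1 by blast
    then show ?thesis by (auto simp: matrix_vector_mul_lid)
  qed
  then obtain a b where a: "a \<in> insert (mat 1) unipotents" and b: "b \<in> unipotents"
    and ab: "a *v (b *v z) = k *v z" unfolding w_def by blast
  have det: "det (a ** b) = 1" using a b by (auto simp: unipotents_def det_mul)
  then have "invertible (a ** b)" by (simp add: invertible_det_nz)
  then obtain m where m: "(a ** b) ** m = mat 1" "m ** (a ** b) = mat 1" by (auto simp: invertible_def)
  define c where "c = m ** k"
  have k: "k = a ** (b ** c)" unfolding c_def using m by (simp add: matrix_mul_assoc)
  have "c *v z = m *v ((a ** b) *v z)" unfolding c_def using ab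
    by (simp add: matrix_vector_mul_assoc[symmetric])
  then have cz: "c *v z = z" using m by (simp add: matrix_vector_mul_assoc matrix_vector_mul_lid)
  have "det c = 1" using arg_cong[OF k, of det] assms det by (simp add: det_mul mult.assoc[symmetric])
  moreover have "trace c = 2"
  proof -
    have "(c - mat 1) *v z = 0" using cz by (simp add: matrix_vector_mult_diff_rdistrib matrix_vector_mul_lid)
    then have "det (c - mat 1) = 0" using mat_mult_vec_eq_0 z by blast
    then show ?thesis using \<open>det c = 1\<close> by (simp add: det_minus_one_2)
  qed
  ultimately have "c \<in> insert (mat 1) unipotents" by (auto simp: unipotents_def)
  then show thesis using that[OF a _ _ k] b by blast
qed

text \<open>Connectedness is strong connectedness of the symmetric closure, so a directed walk by
  left multiplications with unipotents suffices. Writing the quotient of two vertices as three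
  factors gives such a walk.\<close>

lemma connected_cayley_graph_SL:
  assumes "unipotents \<subseteq> (T :: ('a::field ^ 2 ^ 2) set)"
  shows "Digraph_Component.connected (with_proj (cayley_graph SL T))"
proof -
  let ?H = "with_proj (mk_symmetric (with_proj (cayley_graph SL T)))"
  interpret SL: group "SL :: ('a ^ 2 ^ 2) monoid" by (rule group_SL)
  have verts: "verts ?H = {A. det A = 1}" by (simp add: cayley_graph_def carrier_SL)
  interpret H: wf_digraph ?H
    by unfold_locales (auto simp: mk_symmetric_def cayley_graph_def)
  have step: "g \<rightarrow>\<^sup>*\<^bsub>?H\<^esub> (u ** g)" if "det g = 1" "u \<in> insert (mat 1) unipotents" for g u :: "'a ^ 2 ^ 2"
  proof (cases "u = mat 1")
    case True
    then show ?thesis using that verts by (auto intro: H.reachable_refl)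
  next
    case False
    then have u: "u \<in> unipotents" "det u = 1" using that by (auto simp: unipotents_def)
    have "u \<in> carrier SL" "g \<in> carrier SL" using u that by (simp_all add: carrier_SL)
    then have "u \<otimes>\<^bsub>SL\<^esub> g \<otimes>\<^bsub>SL\<^esub> inv\<^bsub>SL\<^esub> g = u" by (simp add: SL.m_assoc)
    then have "(g, u ** g) \<in> parcs (cayley_graph SL T)"
      using u that assms by (auto simp: cayley_graph_def carrier_SL mult_SL det_mul)
    then have "(g, u ** g) \<in> arcs_ends ?H" by (auto simp: mk_symmetric_def)
    then show ?thesis by (rule H.reachable_adjI)
  qed
  have "g \<rightarrow>\<^sup>*\<^bsub>?H\<^esub> h" if g: "det g = 1" and h: "det h = 1" for g h :: "'a ^ 2 ^ 2"
  proof -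
    define k where "k = h \<otimes>\<^bsub>SL\<^esub> inv\<^bsub>SL\<^esub> g"
    have "g \<in> carrier SL" "h \<in> carrier SL" using g h by (simp_all add: carrier_SL)
    then have "k \<in> carrier SL" "h = k \<otimes>\<^bsub>SL\<^esub> g" by (simp_all add: k_def SL.m_assoc)
    then have k: "det k = 1" "h = k ** g" by (simp_all add: carrier_SL mult_SL)
    obtain a b c where abc: "a \<in> insert (mat 1) unipotents" "b \<in> insert (mat 1) unipotents"
      "c \<in> insert (mat 1) unipotents" "k = a ** (b ** c)"
      using SL_eq_product_unipotents[OF k(1)] by blast
    then have det: "det a = 1" "det b = 1" "det c = 1" by (auto simp: unipotents_def)
    \<comment> \<open>Steps multiply on the left, so the rightmost factor \<open>c\<close> comes
      first.\<close>
    have "g \<rightarrow>\<^sup>*\<^bsub>?H\<^esub> (c ** g)" using step g abc by blast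
    also have "(c ** g) \<rightarrow>\<^sup>*\<^bsub>?H\<^esub> (b ** (c ** g))"
      using g det abc by (intro step) (simp_all add: det_mul)
    also have "(b ** (c ** g)) \<rightarrow>\<^sup>*\<^bsub>?H\<^esub> (a ** (b ** (c ** g)))"
      using g det abc by (intro step) (simp_all add: det_mul)
    also have "a ** (b ** (c ** g)) = h" by (simp add: k(2) abc(4) matrix_mul_assoc)
    finally show ?thesis .
  qed
  then show ?thesis
    unfolding Digraph_Component.connected_def strongly_connected_def
    using verts by (auto intro!: exI[of _ "mat 1"])
qed

text \<open>The connection set is a disjoint union of -1, U and -U, separated by trace and by the
  exclusion of the identity from U. A sign on \<open>s\<close> can be moved to
  \<open>g\<close>.\<close>

lemma sum_insert_minus_one_unipotents:
  fixes f :: "'a::{field,finite} ^ 2 ^ 2 \<Rightarrow> complex"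
  assumes "(2 :: 'a) \<noteq> 0"
  shows "(\<Sum>s\<in>{- mat 1} \<union> {g. g \<in> unipotents \<or> - g \<in> unipotents}. f (s ** g)) =
    f (- g) + unipotent_sum f g + unipotent_sum f (- g)"
proof -
  have tr: "trace (- u) = - trace u" for u :: "'a ^ 2 ^ 2" by (simp add: trace2)
  have neg: "{g :: 'a ^ 2 ^ 2. - g \<in> unipotents} = uminus ` unipotents"
    by (auto intro!: image_eqI[of _ uminus "- _"])
  have disj: "unipotents \<inter> uminus ` unipotents = ({} :: ('a ^ 2 ^ 2) set)"
    using two_neq_minus_two[OF assms] by (auto simp: unipotents_def tr)
  have tr1: "trace (- mat 1 :: 'a ^ 2 ^ 2) = - 2" by (simp add: trace2)
  have notin: "- mat 1 \<notin> (unipotents :: ('a ^ 2 ^ 2) set) \<union> uminus ` unipotents"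
    using two_neq_minus_two[OF assms] tr1 by (auto simp: unipotents_def)
  have "{g :: 'a ^ 2 ^ 2. g \<in> unipotents \<or> - g \<in> unipotents} = unipotents \<union> uminus ` unipotents"
    using neg by blast
  then have "(\<Sum>s\<in>{- mat 1} \<union> {g. g \<in> unipotents \<or> - g \<in> unipotents}. f (s ** g)) =
    f (- mat 1 ** g) + ((\<Sum>s\<in>unipotents. f (s ** g)) + (\<Sum>s\<in>uminus ` unipotents. f (s ** g)))"
    using notin disj by (simp add: sum.union_disjoint)
  also have "(\<Sum>s\<in>uminus ` unipotents. f (s ** g)) = unipotent_sum f (- g)"
    by (subst sum.reindex) (auto simp: unipotent_sum_def uminus_mat2_mult mat2_mult_uminus inj_on_def)
  finally show ?thesis by (simp add: unipotent_sum_def uminus_mat2_mult matrix_mul_lid)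
qed

text \<open>Evenness is the arithmetic input for the time pi/2: with U and -U together, an
  eigenvalue \<open>2 * m\<close> enters as 4m. The equation is required only on the group.\<close>

definition has_even_eigenvalue :: "('a::{field,finite} ^ 2 ^ 2 \<Rightarrow> complex) \<Rightarrow> bool" where
  "has_even_eigenvalue f \<longleftrightarrow> (\<exists>m :: int. \<forall>g. det g = 1 \<longrightarrow> unipotent_sum f g = 2 * of_int m * f g)"

lemma has_even_eigenvalueI:
  assumes "even n" "\<And>g. det g = 1 \<Longrightarrow> unipotent_sum f g = of_int n * f g"
  shows "has_even_eigenvalue f"
  using assms unfolding has_even_eigenvalue_def by (auto elim!: evenE)

lemma delta_combination_even_eigenvalues:
  fixes a :: "'a::{field,finite} ^ 2 ^ 2"
  assumes "odd CARD('a)" "det a = 1"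
  obtains f1 f2 f3 f4 and c1 c2 c3 c4 :: complex where
    "has_even_eigenvalue f1" "has_even_eigenvalue f2" "has_even_eigenvalue f3" "has_even_eigenvalue f4"
    "\<And>g. of_bool (g = a) = c1 * f1 g + c2 * f2 g + c3 * f3 g + c4 * f4 g"
proof -
  define q :: complex where "q = of_nat CARD('a)"
  define n where "n = int CARD('a)"
  have n: "q = of_int n" "odd n" using assms(1) by (simp_all add: n_def q_def)
  \<comment> \<open>On the span of \<open>1\<close>, \<open>\<beta>\<close>, \<open>\<phi>\<close>, \<open>\<delta>\<close> the operator is triangular; \<open>f1\<close> to \<open>f4\<close> diagonalise it, with
    eigenvalues \<open>q\<^sup>2 - 1\<close>, \<open>0\<close>, \<open>q - 1\<close>, \<open>- (q + 1)\<close>.\<close>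
  let ?\<delta> = "\<lambda>g. of_bool (g = a) :: complex"
  let ?\<phi> = "scaled_agreements a 1"
  let ?\<beta> = "projective_agreements a"
  define f1 :: "'a ^ 2 ^ 2 \<Rightarrow> complex" where "f1 = (\<lambda>g. 1)"
  define f2 where "f2 = (\<lambda>g. ?\<beta> g + - (q - 1))"
  define f3 where "f3 = (\<lambda>g. (q - 1) * ?\<phi> g + (-1) * ?\<beta> g)"
  define f4 where "f4 = (\<lambda>g. 2 * q * (q\<^sup>2 - 1) * ?\<delta> g + - (q + 1) * ?\<phi> g + (-1) * ?\<beta> g + 2 * (q - 1))"
  have "CARD('a) \<ge> 2"
    using card_mono[of "UNIV :: 'a set" "{0, 1}"] by simp
  then have "real CARD('a) \<ge> 2" by simp
  then have q1: "q - 1 \<noteq> 0" and q0: "q \<noteq> 0" and q2: "q + 1 \<noteq> 0"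
    unfolding q_def by (auto simp: complex_eq_iff)
  have \<phi>: "unipotent_sum ?\<phi> g = (q - 1) * ?\<phi> g + (q\<^sup>2 - 1) - ?\<beta> g" if "det g = 1" for g
    using unipotent_sum_scaled_agreements[OF assms(2) that, of 1] by (simp add: q_def)
  have \<beta>: "unipotent_sum ?\<beta> g = (q - 1) * (q\<^sup>2 - 1)" if "det g = 1" for g
    using unipotent_sum_projective_agreements[OF assms(2) that] by (simp add: q_def)
  have \<delta>: "(q - 1) * unipotent_sum ?\<delta> g = ?\<phi> g - (q\<^sup>2 - 1) * ?\<delta> g" if "det g = 1" for g
    using unipotent_sum_delta[OF assms(2) that] by (simp add: q_def)
  have const: "unipotent_sum (\<lambda>_. c) g = (q\<^sup>2 - 1) * c" for c and g :: "'a ^ 2 ^ 2"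
    by (simp add: unipotent_sum_const q_def)
  note av = unipotent_sum_add unipotent_sum_scale const
  have "has_even_eigenvalue f1"
    by (rule has_even_eigenvalueI[of "n\<^sup>2 - 1"]) (use n in \<open>simp_all add: f1_def const\<close>)
  moreover have "has_even_eigenvalue f2"
  proof (rule has_even_eigenvalueI[of 0])
    fix g :: "'a ^ 2 ^ 2" assume g: "det g = 1"
    show "unipotent_sum f2 g = of_int 0 * f2 g"
      unfolding f2_def av \<beta>[OF g] by (simp add: algebra_simps)
  qed simp
  moreover have "has_even_eigenvalue f3"
  proof (rule has_even_eigenvalueI[of "n - 1"])
    fix g :: "'a ^ 2 ^ 2" assume g: "det g = 1"
    show "unipotent_sum f3 g = of_int (n - 1) * f3 g"
      unfolding f3_def av \<phi>[OF g] \<beta>[OF g] using n(1) by (simp add: algebra_simps)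
  qed (use n in simp)
  moreover have "has_even_eigenvalue f4"
  proof (rule has_even_eigenvalueI[of "- (n + 1)"])
    fix g :: "'a ^ 2 ^ 2" assume g: "det g = 1"
    \<comment> \<open>The formula for the delta function carries a factor q - 1, which is split off
      from q^2 - 1 here.\<close>
    have "2 * q * (q\<^sup>2 - 1) * unipotent_sum ?\<delta> g = 2 * q * (q + 1) * ((q - 1) * unipotent_sum ?\<delta> g)"
      by (simp add: power2_eq_square algebra_simps)
    also have "\<dots> = 2 * q * (q + 1) * (?\<phi> g - (q\<^sup>2 - 1) * ?\<delta> g)"
      by (simp only: \<delta>[OF g])
    finally show "unipotent_sum f4 g = of_int (- (n + 1)) * f4 g"
      unfolding f4_def av \<phi>[OF g] \<beta>[OF g] using n(1)
      by (simp add: power2_eq_square algebra_simps)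
  qed (use n in simp)
  \<comment> \<open>The weights make the contributions of \<open>?\<phi>\<close>,
    \<open>?\<beta>\<close> and the constants cancel, leaving a nonzero multiple of
    \<open>?\<delta>\<close>.\<close>
  moreover have "?\<delta> g = inverse (2 * q * (q\<^sup>2 - 1) * (q - 1)) *
      ((q - 1) * f4 g + (q + 1) * f3 g + 2 * q * f2 g + 2 * (q - 1) * f1 g)" for g
  proof -
    have "(q - 1) * f4 g + (q + 1) * f3 g + 2 * q * f2 g + 2 * (q - 1) * f1 g =
        (2 * q * (q\<^sup>2 - 1) * (q - 1)) * ?\<delta> g"
      unfolding f1_def f2_def f3_def f4_def by (simp add: power2_eq_square algebra_simps)
    moreover have "q\<^sup>2 - 1 = (q - 1) * (q + 1)" by (simp add: power2_eq_square algebra_simps)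
    then have "2 * q * (q\<^sup>2 - 1) * (q - 1) \<noteq> 0" using q0 q1 q2 by simp
    ultimately show ?thesis by (simp add: divide_simps)
  qed
  ultimately show thesis
    using that[of f1 f2 f3 f4 "inverse (2 * q * (q\<^sup>2 - 1) * (q - 1)) * (2 * (q - 1))"
        "inverse (2 * q * (q\<^sup>2 - 1) * (q - 1)) * (2 * q)"
        "inverse (2 * q * (q\<^sup>2 - 1) * (q - 1)) * (q + 1)"
        "inverse (2 * q * (q\<^sup>2 - 1) * (q - 1)) * (q - 1)"]
    by (simp add: algebra_simps)
qed

lemma perfect_state_transfer_SL:
  fixes a :: "'a::{field,finite} ^ 2 ^ 2"
  assumes "odd CARD('a)" "(2 :: 'a) \<noteq> 0" "det a = 1"
  defines "T \<equiv> {- mat 1} \<union> {g. g \<in> unipotents \<or> - g \<in> unipotents}"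
  shows "perfect_state_transfer (cayley_graph SL T) a (- a)"
proof -
  let ?V = "carrier SL :: ('a ^ 2 ^ 2) set"
  define A where "A = adjacency_matrix (cayley_graph SL T)"
  define E where "E = mat_exp ?V (\<lambda>v w. - \<i> * of_real (pi / 2) * A v w)"
  have T: "T \<subseteq> ?V" unfolding T_def
    using det_uminus_2 by (auto simp: carrier_SL det_uminus_2 unipotents_def)
  have A: "mat_vec ?V A f g = f (- g) + unipotent_sum f g + unipotent_sum f (- g)" if "g \<in> ?V" for f g
    unfolding A_def mat_vec_cayley_graph[OF group_SL finite T that] mult_SL unfolding T_def
    by (rule sum_insert_minus_one_unipotents) fact
  have E: "mat_vec ?V E f g = exp (- \<i> * of_real (pi / 2) * c) * f g"
    if "\<And>g. g \<in> ?V \<Longrightarrow> mat_vec ?V A f g = c * f g" "g \<in> ?V" for f g c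
    unfolding E_def
    by (rule mat_exp_eigenvector) (simp_all only: mat_vec_scale_matrix that finite mult.assoc)
  have av_neg: "unipotent_sum (\<lambda>g. f (- g)) g = unipotent_sum f (- g)" for f and g :: "'a ^ 2 ^ 2"
    by (simp add: unipotent_sum_def mat2_mult_uminus)
  have E_even: "mat_vec ?V E (\<lambda>g. f g + f (- g)) g = - \<i> * (f g + f (- g))"
    if f: "has_even_eigenvalue f" and g: "g \<in> ?V" for f g
  proof -
    obtain m where m: "unipotent_sum f g = 2 * of_int m * f g" if "det g = 1" for g
      using f by (auto simp: has_even_eigenvalue_def)
    \<comment> \<open>On an even function the generator -1 contributes 1, and U and -U contribute
      \<open>2 * m\<close> each.\<close>
    have "mat_vec ?V A (\<lambda>g. f g + f (- g)) g = (1 + 2 * (2 * of_int m)) * (f g + f (- g))"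
      if "g \<in> ?V" for g
      using m[of g] m[of "- g"] that unfolding A[OF that] unipotent_sum_add av_neg
      by (simp add: carrier_SL det_uminus_2 algebra_simps)
    from E[OF this g] show ?thesis by (simp only: exp_neg_half_pi_i_odd)
  qed
  have E_odd: "mat_vec ?V E (\<lambda>g. f g + (-1) * f (- g)) g = \<i> * (f g + (-1) * f (- g))"
    if g: "g \<in> ?V" for f g
  proof -
    \<comment> \<open>On an odd function the contributions of U and -U cancel, leaving only the sign
      from the generator -1.\<close>
    have "mat_vec ?V A (\<lambda>g. f g + (-1) * f (- g)) g = (-1) * (f g + (-1) * f (- g))" if "g \<in> ?V" for g
      unfolding A[OF that] unipotent_sum_add unipotent_sum_scale av_neg by (simp add: algebra_simps)
    from E[OF this g] show ?thesis by (simp add: exp_half_pi_i[simplified])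
  qed
  let ?\<delta> = "\<lambda>g. of_bool (g = a) :: complex"
  obtain f1 f2 f3 f4 and c1 c2 c3 c4 :: complex where f: "has_even_eigenvalue f1"
      "has_even_eigenvalue f2" "has_even_eigenvalue f3" "has_even_eigenvalue f4"
    and \<delta>: "\<And>g. ?\<delta> g = c1 * f1 g + c2 * f2 g + c3 * f3 g + c4 * f4 g"
    using delta_combination_even_eigenvalues[OF assms(1,3)] by blast
  \<comment> \<open>Symmetrising the decomposition of the delta function writes its even part
    through the even parts of the four eigenfunctions.\<close>
  have \<delta>_even: "(\<lambda>g. ?\<delta> g + ?\<delta> (- g)) = (\<lambda>g. c1 * (f1 g + f1 (- g)) + c2 * (f2 g + f2 (- g)) +
      c3 * (f3 g + f3 (- g)) + c4 * (f4 g + f4 (- g)))"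
    unfolding \<delta> by (simp add: algebra_simps)
  have "mat_vec ?V E (basis_vec a) g = - \<i> * basis_vec (- a) g" if g: "g \<in> ?V" for g
  proof -
    let ?W = "\<lambda>f. mat_vec ?V E f g = - \<i> * f g"
    have add: "?W (\<lambda>g. f g + h g)" if "?W f" "?W h" for f h
      using that by (simp add: mat_vec_add algebra_simps)
    have scale: "?W (\<lambda>g. c * f g)" if "?W f" for c f
      using that by (simp add: mat_vec_scale)
    define h where "h = (\<lambda>g. ?\<delta> g + ?\<delta> (- g))"
    have "?W h"
      unfolding h_def \<delta>_even by (intro add scale E_even f g)
    moreover define k where "k = (\<lambda>g. ?\<delta> g + (-1) * ?\<delta> (- g))"
    have "mat_vec ?V E k g = \<i> * k g"
      unfolding k_def by (rule E_odd) fact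
    \<comment> \<open>The basis vector is half its even part plus half its odd part; the opposite
      phases -i and i turn this into -i times the basis vector at \<open>- a\<close>.\<close>
    moreover have "basis_vec a = (\<lambda>g. 1 / 2 * h g + 1 / 2 * k g)"
      by (auto simp: basis_vec_def fun_eq_iff h_def k_def algebra_simps)
    ultimately have "mat_vec ?V E (basis_vec a) g = 1 / 2 * (- \<i> * h g) + 1 / 2 * (\<i> * k g)"
      by (simp only: mat_vec_add mat_vec_scale)
    also have "\<dots> = - \<i> * ?\<delta> (- g)" by (simp add: h_def k_def algebra_simps)
    also have "?\<delta> (- g) = basis_vec (- a) g"
      by (auto simp: basis_vec_def minus_equation_iff)
    finally show ?thesis .
  qed
  moreover have "a \<noteq> - a"
  proof
    assume "a = - a"
    then have "a$i$j = - (a$i$j)" for i j by (metis vector_uminus_component)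
    then have "2 * a$i$j = 0" for i j by (metis add_eq_0_iff mult_2)
    then have "a$i$j = 0" for i j using assms(2) by (metis mult_eq_0_iff)
    then show False using assms(3) by (simp add: det_2)
  qed
  moreover have "pverts (cayley_graph SL T) = ?V" by (simp add: cayley_graph_def)
  ultimately show ?thesis
    unfolding perfect_state_transfer_def using assms(3)
    by (auto simp: carrier_SL det_uminus_2 E_def A_def intro!: exI[of _ "pi / 2"] exI[of _ "- \<i>"]
        simp del: mult_minus_left)
qed

theorem theorem4p16:
  fixes p n q :: nat
    and G :: "('a::{field,finite} ^ 2 ^ 2) monoid"
    and t :: "'a ^ 2 ^ 2"
    and S :: "('a ^ 2 ^ 2) set"
    and \<Gamma> :: "('a ^ 2 ^ 2) pair_pre_digraph"
  assumes "prime p" and "odd p" and "n \<ge> 1" and "q = p ^ n"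
    and "CARD('a) = q"
  defines "G \<equiv> SL"
    and "t \<equiv> - mat 1"
    and "S \<equiv> {g \<in> carrier G. group.ord G g = p \<or> group.ord G g = 2 * p}"
    and "\<Gamma> \<equiv> cayley_graph G ({t} \<union> S)"
  shows "Digraph_Component.connected (with_proj \<Gamma>)
    \<and> (\<forall>x\<in>carrier G. perfect_state_transfer \<Gamma> x (x \<otimes>\<^bsub>G\<^esub> t))"
proof -
  have odd: "odd CARD('a)" using assms(2,4,5) by simp
  \<comment> \<open>The cardinality \<open>p ^ n\<close> vanishes in the field, and a field has no
    nonzero nilpotents.\<close>
  have p0: "of_nat p = (0 :: 'a)"
    using of_nat_CARD_eq_0[where 'a = 'a] assms(4,5) by simp
  have two: "(2 :: 'a) \<noteq> 0"
  proof
    assume 2: "(2 :: 'a) = 0"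
    obtain k where "p = 2 * k + 1" using assms(2) by (rule oddE)
    \<comment> \<open>If 2 were zero, the odd \<open>p\<close> would be 1 in the field instead of
      0.\<close>
    then show False using p0 2 by simp
  qed
  have S: "S = {g. g \<in> unipotents \<or> - g \<in> unipotents}"
    unfolding S_def G_def carrier_SL
    using ord_SL_eq_prime_iff[OF assms(1) p0] ord_SL_eq_twice_prime_iff[OF assms(1,2) p0 two]
    by (auto simp: unipotents_def det_uminus_2)
  have "Digraph_Component.connected (with_proj \<Gamma>)"
    unfolding \<Gamma>_def G_def S by (rule connected_cayley_graph_SL) auto
  moreover have "perfect_state_transfer \<Gamma> x (x \<otimes>\<^bsub>G\<^esub> t)" if "x \<in> carrier G" for x
  proof -
    \<comment> \<open>As \<open>t\<close> is central, right translation by it is negation.\<close>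
    have "x \<otimes>\<^bsub>G\<^esub> t = - x" by (simp add: G_def t_def mult_SL mat2_mult_uminus)
    then show ?thesis
      unfolding \<Gamma>_def S using perfect_state_transfer_SL[OF odd two, of x] that
      by (simp add: G_def t_def carrier_SL)
  qed
  ultimately show ?thesis by blast
qed

end
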